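(* Let $(M,g)$ be a compact Riemannian manifold of dimension $n\ge 3$. If $g$ is a harmonic critical metric, then $g$ is the metric of a Ricci soliton. More precisely, if $\theta$ is a smooth 1-form satisfying $E_g=B_g^*\theta-\frac{n-2}{2n}\bar s_g\,g$ and $X=\theta^\#$, then $$\mathrm{Ric}_g+\frac12\mathcal L_{(-X)}g=\lambda g,\qquad \lambda=\frac{\bar s_g}{n}=\frac{1}{n\,\mathrm{Vol}(M,g)}\int_M s_g\,dv_g .$$ Moreover, $$\mathrm{div}_g X=s_g-\bar s_g .$$
   Context: Notation: $\mathrm{Ric}_g$ is the Ricci tensor, $s_g$ the scalar curvature, $E_g=\mathrm{Ric}_g-\frac12 s_g g$ the Einstein tensor, $\bar s_g=\frac{1}{\mathrm{Vol}(M,g)}\int_M s_g\,dv_g$ the average scalar curvature, $\mathcal L$ the Lie derivative, $\theta^\#$ the vector field $g$-dual to $\theta$, and $\mathrm{div}_g X=\nabla_i X^i$. For a 1-form $\theta$: $\delta\theta=-\nabla^i\theta_i$, $(\delta^*\theta)_{ij}=\frac12(\nabla_i\theta_j+\nabla_j\theta_i)$, and $B_g^*\theta=\delta^*\theta+\frac12(\delta\theta)g$. A Riemannian metric $g$ on a compact $n$-manifold is called harmonic critical if there exists a smooth 1-form $\theta$ (called a gauge one-form) such that $E_g=B_g^*\theta-\frac{n-2}{2n}\bar s_g\,g$. $g$ is the metric of a Ricci soliton if there exist a smooth vector field $V$ and a constant $\lambda\in\mathbb R$ (the soliton constant) with $\mathrm{Ric}_g+\frac12\mathcal L_V g=\lambda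 g$. *)

theory Defs
  imports "HOL-Analysis.Analysis"
begin

section \<open>Smooth maps on open subsets of normed spaces\<close>

text \<open>Only meant for open sets: the derivatives are taken with respect to the full
  neighbourhood filter of a point.\<close>

primrec Ck_on ::
  "nat \<Rightarrow> 'a::real_normed_vector set \<Rightarrow> ('a \<Rightarrow> 'b::real_normed_vector) \<Rightarrow> bool" where
  "Ck_on 0 S f \<longleftrightarrow> continuous_on S f"
| "Ck_on (Suc k) S f \<longleftrightarrow> (\<forall>x\<in>S. f differentiable (at x)) \<and>
     (\<forall>v. Ck_on k S (\<lambda>x. frechet_derivative f (at x) v))"

definition smooth_on ::
  "'a::real_normed_vector set \<Rightarrow> ('a \<Rightarrow> 'b::real_normed_vector) \<Rightarrow> bool" where
  "smooth_on S f \<longleftrightarrow> (\<forall>k. Ck_on k S f)"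


section \<open>Smooth manifolds\<close>

type_synonym ('a, 'n) chart = "'a set \<times> ('a \<Rightarrow> real ^ 'n)"

abbreviation chart_dom :: "('a, 'n) chart \<Rightarrow> 'a set" where
  "chart_dom c \<equiv> fst c"

abbreviation chart_map :: "('a, 'n) chart \<Rightarrow> 'a \<Rightarrow> real ^ 'n" where
  "chart_map c \<equiv> snd c"

definition chart_img :: "('a, 'n) chart \<Rightarrow> (real ^ 'n) set" where
  "chart_img c = chart_map c ` chart_dom c"

definition is_chart :: "'a topology \<Rightarrow> ('a, 'n::finite) chart \<Rightarrow> bool" where
  "is_chart M c \<longleftrightarrow> openin M (chart_dom c) \<and> open (chart_img c) \<and>
     homeomorphic_map (subtopology M (chart_dom c)) (top_of_set (chart_img c)) (chart_map c)"

definition overlap :: "('a, 'n) chart \<Rightarrow> ('a, 'n) chart \<Rightarrow> (real ^ 'n) set" where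
  "overlap c d = chart_map c ` (chart_dom c \<inter> chart_dom d)"

text \<open>The change of coordinates from \<open>c\<close> to \<open>d\<close>, meaningful on \<open>overlap c d\<close>.\<close>

definition transition :: "('a, 'n) chart \<Rightarrow> ('a, 'n) chart \<Rightarrow> real ^ 'n \<Rightarrow> real ^ 'n" where
  "transition c d = chart_map d \<circ> inv_into (chart_dom c) (chart_map c)"

text \<open>A smooth manifold without boundary of dimension \<open>CARD('n)\<close>. The atlas need not be maximal.\<close>

definition smooth_manifold :: "'a topology \<Rightarrow> ('a, 'n::finite) chart set \<Rightarrow> bool" where
  "smooth_manifold M A \<longleftrightarrow> Hausdorff_space M \<and> second_countable M \<and>
     (\<forall>c\<in>A. is_chart M c) \<and> (\<Union>c\<in>A. chart_dom c) = topspace M \<and>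
     (\<forall>c\<in>A. \<forall>d\<in>A. smooth_on (overlap c d) (transition c d))"


section \<open>Tensor fields\<close>

text \<open>A tensor field is given by its components in every chart of the atlas, as functions of the
  coordinates of that chart, subject to the transformation law of its type under changes of
  charts. Component functions are only constrained on the images of the charts. With
  \<open>J\<close> the Jacobian matrix of the change of coordinates from \<open>c\<close> to \<open>d\<close>, the laws read
  \<open>V'^a = J^a_i V^i\<close>, \<open>\<theta>_i = J^a_i \<theta>'_a\<close> and \<open>g_ij = J^a_i J^b_j g'_ab\<close>, where primes refer
  to \<open>d\<close>.\<close>

type_synonym ('a, 'n, 'b) field = "('a, 'n) chart \<Rightarrow> real ^ 'n \<Rightarrow> 'b"

definition transition_jacobian ::
  "('a, 'n::finite) chart \<Rightarrow> ('a, 'n) chart \<Rightarrow> real ^ 'n \<Rightarrow> real ^ 'n ^ 'n" where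
  "transition_jacobian c d x = jacobian (transition c d) (at x)"

definition smooth_vector_field ::
  "('a, 'n::finite) chart set \<Rightarrow> ('a, 'n, real ^ 'n) field \<Rightarrow> bool" where
  "smooth_vector_field A V \<longleftrightarrow>
     (\<forall>c\<in>A. smooth_on (chart_img c) (V c)) \<and>
     (\<forall>c\<in>A. \<forall>d\<in>A. \<forall>x\<in>overlap c d.
        V d (transition c d x) = transition_jacobian c d x *v V c x)"

definition smooth_one_form ::
  "('a, 'n::finite) chart set \<Rightarrow> ('a, 'n, real ^ 'n) field \<Rightarrow> bool" where
  "smooth_one_form A \<theta> \<longleftrightarrow>
     (\<forall>c\<in>A. smooth_on (chart_img c) (\<theta> c)) \<and>
     (\<forall>c\<in>A. \<forall>d\<in>A. \<forall>x\<in>overlap c d.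
        \<theta> c x = transpose (transition_jacobian c d x) *v \<theta> d (transition c d x))"

definition riemannian_metric ::
  "('a, 'n::finite) chart set \<Rightarrow> ('a, 'n, real ^ 'n ^ 'n) field \<Rightarrow> bool" where
  "riemannian_metric A g \<longleftrightarrow>
     (\<forall>c\<in>A. smooth_on (chart_img c) (g c)) \<and>
     (\<forall>c\<in>A. \<forall>x\<in>chart_img c. transpose (g c x) = g c x \<and>
        (\<forall>v. v \<noteq> 0 \<longrightarrow> v \<bullet> (g c x *v v) > 0)) \<and>
     (\<forall>c\<in>A. \<forall>d\<in>A. \<forall>x\<in>overlap c d.
        g c x = transpose (transition_jacobian c d x) ** g d (transition c d x)
                  ** transition_jacobian c d x)"


section \<open>Riemannian geometry in local coordinates\<close>

text \<open>Throughout, \<open>G\<close> is the component matrix of the metric in one chart.\<close>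

definition partial :: "'n::finite \<Rightarrow> (real ^ 'n \<Rightarrow> real) \<Rightarrow> real ^ 'n \<Rightarrow> real" where
  "partial i f x = frechet_derivative f (at x) (axis i 1)"

definition metric_inv :: "(real ^ 'n \<Rightarrow> real ^ 'n ^ 'n) \<Rightarrow> real ^ 'n \<Rightarrow> real ^ 'n ^ 'n::finite" where
  "metric_inv G x = matrix_inv (G x)"

text \<open>\<open>christoffel G k i j\<close> is \<open>\<Gamma>^k_ij\<close>.\<close>

definition christoffel ::
  "(real ^ 'n \<Rightarrow> real ^ 'n ^ 'n) \<Rightarrow> 'n \<Rightarrow> 'n \<Rightarrow> 'n \<Rightarrow> real ^ 'n::finite \<Rightarrow> real" where
  "christoffel G k i j x = (1/2) * (\<Sum>l\<in>UNIV. metric_inv G x $ k $ l *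
     (partial i (\<lambda>y. G y $ j $ l) x + partial j (\<lambda>y. G y $ i $ l) x
       - partial l (\<lambda>y. G y $ i $ j) x))"

text \<open>\<open>riemann G l k i j\<close> is \<open>R^l_kij\<close>, with the convention
  \<open>R(\<partial>_i, \<partial>_j) \<partial>_k = R^l_kij \<partial>_l\<close>, where
  \<open>R(X,Y) = [\<nabla>_X, \<nabla>_Y] - \<nabla>_[X,Y]\<close>. The Ricci tensor is the contraction
  \<open>Ric_kj = R^i_kij\<close>, which is positive on round spheres.\<close>

definition riemann ::
  "(real ^ 'n \<Rightarrow> real ^ 'n ^ 'n) \<Rightarrow> 'n \<Rightarrow> 'n \<Rightarrow> 'n \<Rightarrow> 'n \<Rightarrow> real ^ 'n::finite \<Rightarrow> real" where
  "riemann G l k i j x =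
     partial i (christoffel G l j k) x - partial j (christoffel G l i k) x
     + (\<Sum>p\<in>UNIV. christoffel G l i p x * christoffel G p j k x)
     - (\<Sum>p\<in>UNIV. christoffel G l j p x * christoffel G p i k x)"

definition ricci ::
  "(real ^ 'n \<Rightarrow> real ^ 'n ^ 'n) \<Rightarrow> real ^ 'n \<Rightarrow> real ^ 'n ^ 'n::finite" where
  "ricci G x = (\<chi> k j. \<Sum>i\<in>UNIV. riemann G i k i j x)"

definition scal :: "(real ^ 'n \<Rightarrow> real ^ 'n ^ 'n) \<Rightarrow> real ^ 'n::finite \<Rightarrow> real" where
  "scal G x = (\<Sum>i\<in>UNIV. \<Sum>j\<in>UNIV. metric_inv G x $ i $ j * ricci G x $ i $ j)"

definition einstein ::
  "(real ^ 'n \<Rightarrow> real ^ 'n ^ 'n) \<Rightarrow> real ^ 'n \<Rightarrow> real ^ 'n ^ 'n::finite" where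
  "einstein G x = ricci G x - (scal G x / 2) *\<^sub>R G x"

text \<open>\<open>nabla_form G \<theta> i j\<close> is \<open>\<nabla>_i \<theta>_j\<close> and \<open>nabla_vec G X i j\<close> is \<open>\<nabla>_i X^j\<close>.\<close>

definition nabla_form ::
  "(real ^ 'n \<Rightarrow> real ^ 'n ^ 'n) \<Rightarrow> (real ^ 'n \<Rightarrow> real ^ 'n) \<Rightarrow> 'n \<Rightarrow> 'n \<Rightarrow> real ^ 'n::finite \<Rightarrow> real"
where
  "nabla_form G \<theta> i j x =
     partial i (\<lambda>y. \<theta> y $ j) x - (\<Sum>k\<in>UNIV. christoffel G k i j x * \<theta> x $ k)"

definition nabla_vec ::
  "(real ^ 'n \<Rightarrow> real ^ 'n ^ 'n) \<Rightarrow> (real ^ 'n \<Rightarrow> real ^ 'n) \<Rightarrow> 'n \<Rightarrow> 'n \<Rightarrow> real ^ 'n::finite \<Rightarrow> real"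
where
  "nabla_vec G X i j x =
     partial i (\<lambda>y. X y $ j) x + (\<Sum>k\<in>UNIV. christoffel G j i k x * X x $ k)"

definition divergence ::
  "(real ^ 'n \<Rightarrow> real ^ 'n ^ 'n) \<Rightarrow> (real ^ 'n \<Rightarrow> real ^ 'n) \<Rightarrow> real ^ 'n::finite \<Rightarrow> real" where
  "divergence G X x = (\<Sum>i\<in>UNIV. nabla_vec G X i i x)"

definition codiff ::
  "(real ^ 'n \<Rightarrow> real ^ 'n ^ 'n) \<Rightarrow> (real ^ 'n \<Rightarrow> real ^ 'n) \<Rightarrow> real ^ 'n::finite \<Rightarrow> real" where
  "codiff G \<theta> x = - (\<Sum>i\<in>UNIV. \<Sum>j\<in>UNIV. metric_inv G x $ i $ j * nabla_form G \<theta> j i x)"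

definition delta_star ::
  "(real ^ 'n \<Rightarrow> real ^ 'n ^ 'n) \<Rightarrow> (real ^ 'n \<Rightarrow> real ^ 'n) \<Rightarrow> real ^ 'n \<Rightarrow> real ^ 'n ^ 'n::finite"
where
  "delta_star G \<theta> x = (\<chi> i j. (1/2) * (nabla_form G \<theta> i j x + nabla_form G \<theta> j i x))"

definition B_star ::
  "(real ^ 'n \<Rightarrow> real ^ 'n ^ 'n) \<Rightarrow> (real ^ 'n \<Rightarrow> real ^ 'n) \<Rightarrow> real ^ 'n \<Rightarrow> real ^ 'n ^ 'n::finite"
where
  "B_star G \<theta> x = delta_star G \<theta> x + (codiff G \<theta> x / 2) *\<^sub>R G x"

text \<open>\<open>(L_V G)_ij = V^k \<partial>_k G_ij + G_kj \<partial>_i V^k + G_ik \<partial>_j V^k\<close>\<close>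

definition lie_metric ::
  "(real ^ 'n \<Rightarrow> real ^ 'n) \<Rightarrow> (real ^ 'n \<Rightarrow> real ^ 'n ^ 'n) \<Rightarrow> real ^ 'n \<Rightarrow> real ^ 'n ^ 'n::finite"
where
  "lie_metric V G x = (\<chi> i j. \<Sum>k\<in>UNIV.
     V x $ k * partial k (\<lambda>y. G y $ i $ j) x
     + G x $ k $ j * partial i (\<lambda>y. V y $ k) x
     + G x $ i $ k * partial j (\<lambda>y. V y $ k) x)"


section \<open>Global notions\<close>

definition sharp ::
  "('a, 'n, real ^ 'n ^ 'n) field \<Rightarrow> ('a, 'n, real ^ 'n) field \<Rightarrow> ('a, 'n::finite, real ^ 'n) field"
where
  "sharp g \<theta> c x = metric_inv (g c) x *v \<theta> c x"

text \<open>The Riemannian volume measure: the unique Borel measure on \<open>M\<close> which in every chart has the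
  density \<open>sqrt (det g)\<close> with respect to Lebesgue measure. No orientation is needed.\<close>

definition volume_measure ::
  "'a topology \<Rightarrow> ('a, 'n::finite) chart set \<Rightarrow> ('a, 'n, real ^ 'n ^ 'n) field \<Rightarrow> 'a measure" where
  "volume_measure M A g = (THE \<mu>. space \<mu> = topspace M \<and>
     sets \<mu> = sigma_sets (topspace M) {U. openin M U} \<and>
     (\<forall>c\<in>A. \<forall>B\<in>sets \<mu>. B \<subseteq> chart_dom c \<longrightarrow>
        emeasure \<mu> B = (\<integral>\<^sup>+x\<in>chart_map c ` B. ennreal (sqrt (det (g c x))) \<partial>lborel)))"

definition total_volume ::
  "'a topology \<Rightarrow> ('a, 'n::finite) chart set \<Rightarrow> ('a, 'n, real ^ 'n ^ 'n) field \<Rightarrow> real" where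
  "total_volume M A g = measure (volume_measure M A g) (topspace M)"

text \<open>The value at \<open>p\<close> does not depend on the chart, by tensoriality of the curvature.\<close>

definition scalar_curvature ::
  "('a, 'n::finite) chart set \<Rightarrow> ('a, 'n, real ^ 'n ^ 'n) field \<Rightarrow> 'a \<Rightarrow> real" where
  "scalar_curvature A g p =
     (let c = (SOME c. c \<in> A \<and> p \<in> chart_dom c) in scal (g c) (chart_map c p))"

definition avg_scalar_curvature ::
  "'a topology \<Rightarrow> ('a, 'n::finite) chart set \<Rightarrow> ('a, 'n, real ^ 'n ^ 'n) field \<Rightarrow> real" where
  "avg_scalar_curvature M A g =
     (1 / total_volume M A g) * (\<integral>p. scalar_curvature A g p \<partial>volume_measure M A g)"

definition gauge_one_form ::
  "'a topology \<Rightarrow> ('a, 'n::finite) chart set \<Rightarrow> ('a, 'n, real ^ 'n ^ 'n) field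
     \<Rightarrow> ('a, 'n, real ^ 'n) field \<Rightarrow> bool" where
  "gauge_one_form M A g \<theta> \<longleftrightarrow> smooth_one_form A \<theta> \<and>
     (\<forall>c\<in>A. \<forall>x\<in>chart_img c. einstein (g c) x = B_star (g c) (\<theta> c) x
        - ((real CARD('n) - 2) / (2 * real CARD('n)) * avg_scalar_curvature M A g) *\<^sub>R g c x)"

definition harmonic_critical ::
  "'a topology \<Rightarrow> ('a, 'n::finite) chart set \<Rightarrow> ('a, 'n, real ^ 'n ^ 'n) field \<Rightarrow> bool" where
  "harmonic_critical M A g \<longleftrightarrow> (\<exists>\<theta>. gauge_one_form M A g \<theta>)"

definition ricci_soliton ::
  "('a, 'n::finite) chart set \<Rightarrow> ('a, 'n, real ^ 'n ^ 'n) field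
     \<Rightarrow> ('a, 'n, real ^ 'n) field \<Rightarrow> real \<Rightarrow> bool" where
  "ricci_soliton A g V lam \<longleftrightarrow> smooth_vector_field A V \<and>
     (\<forall>c\<in>A. \<forall>x\<in>chart_img c.
        ricci (g c) x + (1/2) *\<^sub>R lie_metric (V c) (g c) x = lam *\<^sub>R g c x)"

definition ricci_soliton_metric ::
  "('a, 'n::finite) chart set \<Rightarrow> ('a, 'n, real ^ 'n ^ 'n) field \<Rightarrow> bool" where
  "ricci_soliton_metric A g \<longleftrightarrow> (\<exists>V lam. ricci_soliton A g V lam)"

end

theory Submission
  imports Defs
begin

text \<open>
  The theorem follows by pointwise algebra from the gauge equation, in which the average
  \<open>a\<close> of the scalar curvature is a constant.

  Since \<open>tr (\<delta>\<^sup>* \<theta>) = - \<delta>\<theta>\<close>, the \<open>g\<close>-trace of the gauge equation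
  \<open>Ric - (s/2) g = \<delta>\<^sup>* \<theta> + (\<delta>\<theta>/2) g - ((n-2)/(2n)) a g\<close> is
  \<open>-((n-2)/2) s = ((n-2)/2) (\<delta>\<theta> - a)\<close>, hence \<open>\<delta>\<theta> = a - s\<close> as soon as \<open>n > 2\<close>
  (\<open>codiff_gauge\<close>). Substituting this back, the multiples of \<open>s g\<close> cancel and
  \<open>Ric = \<delta>\<^sup>* \<theta> + (a/n) g\<close> remains (\<open>ricci_gauge\<close>). For the dual vector field \<open>X\<close> of \<open>\<theta>\<close> one
  has \<open>L_X g = 2 \<delta>\<^sup>* \<theta>\<close> and \<open>div X = - \<delta>\<theta>\<close> (\<open>lie_metric_eq_delta_star\<close>,
  \<open>divergence_eq_codiff\<close>), which turns the two equations into the soliton equation for \<open>-X\<close>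
  with constant \<open>a/n\<close> and into \<open>div X = s - a\<close>.

  A soliton also requires \<open>X\<close> to be a smooth vector field. Its components are \<open>G\<^sup>-\<^sup>1 \<theta>\<close>, so
  smoothness comes down to that of matrix inversion (\<open>Ck_on_matrix_inv\<close>), and the transformation
  law follows from those of \<open>g\<close> and \<open>\<theta>\<close> (\<open>sharp_transition\<close>).
\<close>

section \<open>Calculus of \<open>C\<^sup>k\<close> maps\<close>

text \<open>Openness matters: two maps that agree near a point have the same derivative there.\<close>
lemma Ck_on_cong:
  fixes f h :: "'a::real_normed_vector \<Rightarrow> 'b::real_normed_vector"
  assumes "open S" and "\<And>x. x \<in> S \<Longrightarrow> f x = h x" and "Ck_on k S f"
  shows "Ck_on k S h"
  using assms(2,3)
proof (induction k arbitrary: f h)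
  case 0
  have "continuous_on S f \<longleftrightarrow> continuous_on S h"
    by (rule continuous_on_cong[OF refl 0(1)])
  with 0(2) show ?case by simp
next
  case (Suc k)
  have h': "(h has_derivative frechet_derivative f (at x)) (at x)" if x: "x \<in> S" for x
  proof (rule has_derivative_transform_within_open[OF _ assms(1) x Suc.prems(1)])
    show "(f has_derivative frechet_derivative f (at x)) (at x)"
      using Suc.prems(2) x by (simp add: frechet_derivative_works)
  qed
  have eq: "frechet_derivative f (at x) v = frechet_derivative h (at x) v" if "x \<in> S" for x v
    using frechet_derivative_at[OF h'[OF that]] by simp
  have "Ck_on k S (\<lambda>x. frechet_derivative h (at x) v)" for v
  proof (rule Suc.IH)
    show "frechet_derivative f (at x) v = frechet_derivative h (at x) v" if "x \<in> S" for x
      using that by (rule eq)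
    show "Ck_on k S (\<lambda>x. frechet_derivative f (at x) v)"
      using Suc.prems(2) by simp
  qed
  moreover have "h differentiable (at x)" if "x \<in> S" for x
    using h'[OF that] by (rule differentiableI)
  ultimately show ?case by simp
qed

text \<open>Any explicit formula for the derivative may replace the chosen Frechet derivative. The
  closure properties below are inductions on \<open>k\<close> that apply this rule to a differentiation rule.\<close>
lemma Ck_on_SucI:
  assumes "open S"
    and "\<And>x. x \<in> S \<Longrightarrow> (f has_derivative f' x) (at x)"
    and "\<And>v. Ck_on k S (\<lambda>x. f' x v)"
  shows "Ck_on (Suc k) S f"
proof -
  have f': "f' x = frechet_derivative f (at x)" if "x \<in> S" for x
    using assms(2)[OF that] by (rule frechet_derivative_at)
  have "Ck_on k S (\<lambda>x. frechet_derivative f (at x) v)" for v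
    by (rule Ck_on_cong[OF assms(1) _ assms(3)[of v]]) (simp add: f')
  moreover have "f differentiable (at x)" if "x \<in> S" for x
    using assms(2)[OF that] by (rule differentiableI)
  ultimately show ?thesis by simp
qed

lemma Ck_on_has_derivative:
  assumes "Ck_on (Suc k) S f" and "x \<in> S"
  shows "(f has_derivative frechet_derivative f (at x)) (at x)"
  using assms by (simp add: frechet_derivative_works)

lemma Ck_on_Suc_imp_Ck_on: "Ck_on (Suc k) S f \<Longrightarrow> Ck_on k S f"
proof (induction k arbitrary: f)
  case 0
  then show ?case
    by (auto intro!: continuous_at_imp_continuous_on differentiable_imp_continuous_within)
qed (metis Ck_on.simps(2))

lemma Ck_on_add:
  assumes "open S" and "Ck_on k S f" and "Ck_on k S h"
  shows "Ck_on k S (\<lambda>x. f x + h x)"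
  using assms(2,3)
proof (induction k arbitrary: f h)
  case 0
  then show ?case by (simp add: continuous_on_add)
next
  case (Suc k)
  show ?case
    using Suc
    by (intro Ck_on_SucI[OF assms(1), where f' = "\<lambda>x v. frechet_derivative f (at x) v
          + frechet_derivative h (at x) v"] has_derivative_add Ck_on_has_derivative) auto
qed

lemma Ck_on_uminus:
  assumes "open S" and "Ck_on k S f"
  shows "Ck_on k S (\<lambda>x. - f x)"
  using assms(2)
proof (induction k arbitrary: f)
  case 0
  then show ?case by (simp add: continuous_on_minus)
next
  case (Suc k)
  show ?case
    using Suc
    by (intro Ck_on_SucI[OF assms(1), where f' = "\<lambda>x v. - frechet_derivative f (at x) v"]
        has_derivative_minus Ck_on_has_derivative) auto
qed

text \<open>By the Leibniz rule the derivative is again a sum of values of the same bilinear map, at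
  maps that are one degree less regular.\<close>
lemma Ck_on_bilinear:
  assumes "open S" and "bounded_bilinear b" and "Ck_on k S f" and "Ck_on k S h"
  shows "Ck_on k S (\<lambda>x. b (f x) (h x))"
  using assms(3,4)
proof (induction k arbitrary: f h)
  case 0
  then show ?case by (simp add: bounded_bilinear.continuous_on[OF assms(2)])
next
  case (Suc k)
  show ?case
    using Suc assms(1) Ck_on_Suc_imp_Ck_on[OF Suc.prems(1)] Ck_on_Suc_imp_Ck_on[OF Suc.prems(2)]
    by (intro Ck_on_SucI[OF assms(1), where f' = "\<lambda>x v. b (f x) (frechet_derivative h (at x) v)
          + b (frechet_derivative f (at x) v) (h x)"]
        bounded_bilinear.FDERIV[OF assms(2)] Ck_on_has_derivative Ck_on_add) auto
qed

lemma bounded_bilinear_matrix_mult: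
  "bounded_bilinear ((**) :: real^'m^'n \<Rightarrow> real^'p^'m \<Rightarrow> real^'p^'n)"
  unfolding bilinear_conv_bounded_bilinear[symmetric] bilinear_def
  by (auto intro!: linearI simp: matrix_matrix_mult_def vec_eq_iff algebra_simps
      sum.distrib sum_distrib_left)

lemma bounded_bilinear_matrix_vector_mult:
  "bounded_bilinear ((*v) :: real^'m^'n \<Rightarrow> real^'m \<Rightarrow> real^'n)"
  unfolding bilinear_conv_bounded_bilinear[symmetric] bilinear_def
  by (auto intro!: linearI simp: matrix_vector_mult_def vec_eq_iff algebra_simps
      sum.distrib sum_distrib_left)

section \<open>Smoothness of matrix inversion\<close>

lemma matrix_inv:
  assumes "invertible B"
  shows matrix_inv_right: "B ** matrix_inv B = mat 1"
    and matrix_inv_left: "matrix_inv B ** B = mat 1"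
  using someI_ex[OF assms[unfolded invertible_def]] by (simp_all add: matrix_inv_def)

text \<open>Column \<open>l\<close> of the inverse solves the linear system whose right-hand side is the \<open>l\<close>-th basis
  vector. The quotient of determinants shows that the inverse depends differentiably on the
  matrix.\<close>
lemma matrix_inv_cramer:
  fixes B :: "real^'n^'n"
  assumes "invertible B"
  shows "matrix_inv B $ k $ l =
    det (\<chi> i j. if j = k then axis l 1 $ i else B $ i $ j) / det B"
proof -
  have "B *v column l (matrix_inv B) = axis l 1"
    using matrix_inv_right[OF assms]
    by (simp flip: matrix_vector_mult_basis add: matrix_vector_mul_assoc)
  then have "column l (matrix_inv B) =
      (\<chi> k. det (\<chi> i j. if j = k then axis l 1 $ i else B $ i $ j) / det B)"
    using assms by (subst (asm) cramer) (auto simp: invertible_det_nz)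
  then show ?thesis by (simp add: vec_eq_iff column_def)
qed

lemma differentiable_vec_nth:
  fixes f :: "'a::real_normed_vector \<Rightarrow> 'b::real_normed_vector ^ 'n"
  assumes "f differentiable F"
  shows "(\<lambda>x. f x $ i) differentiable F"
proof -
  obtain f' where "(f has_derivative f') F"
    using assms by (auto simp: differentiable_def)
  from bounded_linear.has_derivative[OF bounded_linear_vec_nth this, of i]
  show ?thesis by (auto simp: differentiable_def)
qed

lemma differentiable_vecI:
  fixes f :: "'a::real_normed_vector \<Rightarrow> 'b::euclidean_space ^ 'n"
  assumes "\<And>i. (\<lambda>x. f x $ i) differentiable (at x within T)"
  shows "f differentiable (at x within T)"
proof (subst differentiable_componentwise_within, intro ballI)
  fix b :: "'b^'n"
  assume "b \<in> Basis"
  then obtain i u where "b = axis i u" by (auto simp: Basis_vec_def)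
  then show "(\<lambda>x. f x \<bullet> b) differentiable (at x within T)"
    using differentiable_inner[OF assms[of i] differentiable_const[of u]]
    by (simp add: inner_axis)
qed

lemma differentiable_prod:
  fixes f :: "'i \<Rightarrow> 'a::real_normed_vector \<Rightarrow> real"
  assumes "\<And>i. i \<in> I \<Longrightarrow> f i differentiable (at x within T)"
  shows "(\<lambda>x. \<Prod>i\<in>I. f i x) differentiable (at x within T)"
proof -
  obtain f' where "\<And>i. i \<in> I \<Longrightarrow> (f i has_derivative f' i) (at x within T)"
    using assms unfolding differentiable_def by metis
  from has_derivative_prod[of I f, OF this] show ?thesis
    by (auto simp: differentiable_def)
qed

lemma differentiable_det:
  fixes F :: "'a::real_normed_vector \<Rightarrow> real^'n^'n"
  assumes "\<And>i j. (\<lambda>y. F y $ i $ j) differentiable (at x within T)"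
  shows "(\<lambda>y. det (F y)) differentiable (at x within T)"
  unfolding det_def using assms
  by (auto intro!: differentiable_sum differentiable_mult differentiable_const differentiable_prod)

lemma matrix_inv_differentiable:
  fixes G :: "'a::real_normed_vector \<Rightarrow> real^'n^'n"
  assumes "open S" and "x \<in> S" and "\<And>y. y \<in> S \<Longrightarrow> invertible (G y)"
    and "G differentiable (at x)"
  shows "(\<lambda>y. matrix_inv (G y)) differentiable (at x)"
proof (intro differentiable_vecI)
  fix k l
  have entries: "(\<lambda>y. G y $ i $ j) differentiable (at x)" for i j
    using assms(4) by (intro differentiable_vec_nth)
  then have "(\<lambda>y. (\<chi> i j. if j = k then axis l 1 $ i else G y $ i $ j) $ i $ j)
      differentiable (at x)" for i j
    by (cases "j = k") simp_all
  then have "(\<lambda>y. det (\<chi> i j. if j = k then axis l 1 $ i else G y $ i $ j) / det (G y))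
      differentiable (at x)"
    using assms(3)[OF assms(2)] entries
    by (intro differentiable_divide differentiable_det) (simp_all only: invertible_det_nz not_False_eq_True)
  then obtain D where
    "((\<lambda>y. det (\<chi> i j. if j = k then axis l 1 $ i else G y $ i $ j) / det (G y))
      has_derivative D) (at x)"
    unfolding differentiable_def by blast
  then have "((\<lambda>y. matrix_inv (G y) $ k $ l) has_derivative D) (at x)"
    by (rule has_derivative_transform_within_open[OF _ assms(1,2)])
      (simp add: matrix_inv_cramer assms(3))
  then show "(\<lambda>y. matrix_inv (G y) $ k $ l) differentiable (at x)"
    unfolding differentiable_def by blast
qed

text \<open>Once the inverse \<open>H\<close> is known to be differentiable, differentiating \<open>G H = 1\<close> gives
  \<open>G H' = - G' H\<close>.\<close>
lemma matrix_inv_has_derivative: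
  fixes G :: "'a::real_normed_vector \<Rightarrow> real^'n^'n"
  assumes "open S" and "x \<in> S" and inv: "\<And>y. y \<in> S \<Longrightarrow> invertible (G y)"
    and G': "(G has_derivative G') (at x)"
  shows "((\<lambda>y. matrix_inv (G y)) has_derivative
      (\<lambda>v. - (matrix_inv (G x) ** (G' v ** matrix_inv (G x))))) (at x)"
proof -
  let ?H = "\<lambda>y. matrix_inv (G y)"
  obtain H' where H': "(?H has_derivative H') (at x)"
    using matrix_inv_differentiable[of S x G] assms unfolding differentiable_def by blast
  have "((\<lambda>y. G y ** ?H y) has_derivative (\<lambda>v. G x ** H' v + G' v ** ?H x)) (at x)"
    by (rule bounded_bilinear.FDERIV[OF bounded_bilinear_matrix_mult G' H'])
  moreover have "((\<lambda>y. G y ** ?H y) has_derivative (\<lambda>v. 0)) (at x)"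
    by (rule has_derivative_transform_within_open[OF has_derivative_const[of "mat 1"] assms(1,2)])
      (simp add: matrix_inv_right inv)
  ultimately have "(\<lambda>v. G x ** H' v + G' v ** ?H x) = (\<lambda>v. 0)"
    by (rule has_derivative_unique)
  then have "G x ** H' v = - (G' v ** ?H x)" for v
    by (metis add_eq_0_iff2)
  moreover have "H' v = ?H x ** (G x ** H' v)" for v
    by (simp add: matrix_mul_assoc matrix_inv_left inv[OF assms(2)])
  ultimately have "H' v = - (?H x ** (G' v ** ?H x))" for v
    using bounded_bilinear.minus_right[OF bounded_bilinear_matrix_mult, of "?H x"] by metis
  then have "H' = (\<lambda>v. - (?H x ** (G' v ** ?H x)))" by (rule ext)
  with H' show ?thesis by simp
qed

text \<open>The formula \<open>H' = - H G' H\<close> expresses the derivative of the inverse by the inverse itself, so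
  regularity improves by one degree at each step.\<close>
lemma Ck_on_matrix_inv:
  fixes G :: "'a::real_normed_vector \<Rightarrow> real^'n^'n"
  assumes "open S" and inv: "\<And>y. y \<in> S \<Longrightarrow> invertible (G y)"
    and smooth: "smooth_on S G"
  shows "Ck_on k S (\<lambda>y. matrix_inv (G y))"
proof (induction k)
  have Ck: "Ck_on k S G" for k
    using smooth by (simp add: smooth_on_def)
  note H' = matrix_inv_has_derivative[OF assms(1) _ inv Ck_on_has_derivative[OF Ck]]
  {
    case 0
    show ?case
      using H' by (auto intro!: continuous_at_imp_continuous_on has_derivative_continuous)
  next
    case (Suc k)
    show ?case
      using Ck[of "Suc k"] Suc
      by (intro Ck_on_SucI[OF assms(1) H'] Ck_on_uminus[OF assms(1)]
          Ck_on_bilinear[OF assms(1) bounded_bilinear_matrix_mult]) auto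
  }
qed

section \<open>Identities in one chart\<close>

lemma partial_eqI: "(f has_derivative f') (at x) \<Longrightarrow> partial i f x = f' (axis i 1)"
  by (metis partial_def frechet_derivative_at)

lemma partial_cong:
  assumes "open S" and "x \<in> S" and "\<And>y. y \<in> S \<Longrightarrow> f y = h y"
  shows "partial i f x = partial i h x"
proof -
  have "(f has_derivative D) (at x) \<longleftrightarrow> (h has_derivative D) (at x)" for D
    using assms by (metis has_derivative_transform_within_open)
  then show ?thesis by (simp add: partial_def frechet_derivative_def)
qed

lemma partial_sum_mult:
  fixes a b :: "'k \<Rightarrow> real^'n \<Rightarrow> real"
  assumes "\<And>k. a k differentiable (at x)" and "\<And>k. b k differentiable (at x)"
  shows "partial i (\<lambda>y. \<Sum>k\<in>K. a k y * b k y) x =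
    (\<Sum>k\<in>K. partial i (a k) x * b k x + a k x * partial i (b k) x)"
proof -
  have "((\<lambda>y. \<Sum>k\<in>K. a k y * b k y) has_derivative
      (\<lambda>v. \<Sum>k\<in>K. a k x * frechet_derivative (b k) (at x) v
        + frechet_derivative (a k) (at x) v * b k x)) (at x)"
    using assms by (intro has_derivative_sum has_derivative_mult)
      (auto simp: frechet_derivative_works)
  from partial_eqI[OF this, of i] show ?thesis
    by (simp add: partial_def add.commute)
qed

locale local_metric =
  fixes S :: "(real ^ 'n::finite) set" and G :: "real ^ 'n \<Rightarrow> real ^ 'n ^ 'n"
  assumes open_S: "open S"
    and smooth_G: "smooth_on S G"
    and transpose_G: "x \<in> S \<Longrightarrow> transpose (G x) = G x"
    and pos_def_G: "x \<in> S \<Longrightarrow> v \<noteq> 0 \<Longrightarrow> v \<bullet> (G x *v v) > 0"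
begin

lemma G_sym: "x \<in> S \<Longrightarrow> G x $ i $ j = G x $ j $ i"
  using transpose_G[of x] by (simp add: transpose_def vec_eq_iff)

lemma invertible_G:
  assumes "x \<in> S"
  shows "invertible (G x)"
proof -
  have "v = 0" if "G x *v v = 0" for v
    using pos_def_G[OF assms, of v] that by fastforce
  then show ?thesis
    by (simp add: invertible_left_inverse matrix_left_invertible_ker)
qed

lemma metric_inv_mult_metric:
  assumes "x \<in> S"
  shows "(\<Sum>j\<in>UNIV. metric_inv G x $ i $ j * G x $ j $ k) = (if i = k then 1 else 0)"
    and "(\<Sum>j\<in>UNIV. G x $ i $ j * metric_inv G x $ j $ k) = (if i = k then 1 else 0)"
  using matrix_inv_left[OF invertible_G[OF assms]] matrix_inv_right[OF invertible_G[OF assms]]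
  by (simp_all add: metric_inv_def matrix_matrix_mult_def mat_def vec_eq_iff)

lemma trace_metric:
  assumes "x \<in> S"
  shows "(\<Sum>i\<in>UNIV. \<Sum>j\<in>UNIV. metric_inv G x $ i $ j * G x $ i $ j) = real CARD('n)"
  using metric_inv_mult_metric(1)[OF assms] by (simp add: G_sym[OF assms])

lemma christoffel_sym:
  assumes "x \<in> S"
  shows "christoffel G k i j x = christoffel G k j i x"
proof -
  have "partial l (\<lambda>y. G y $ i $ j) x = partial l (\<lambda>y. G y $ j $ i) x" for l
    by (rule partial_cong[OF open_S assms]) (rule G_sym)
  then show ?thesis by (simp add: christoffel_def add.commute)
qed

text \<open>These are the Christoffel symbols of the first kind, \<open>\<Gamma>_m,ij = G_mk \<Gamma>^k_ij\<close>.\<close>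
lemma lower_christoffel:
  assumes "x \<in> S"
  shows "(\<Sum>k\<in>UNIV. G x $ m $ k * christoffel G k i j x) = (1/2) *
    (partial i (\<lambda>y. G y $ j $ m) x + partial j (\<lambda>y. G y $ i $ m) x
      - partial m (\<lambda>y. G y $ i $ j) x)"
proof -
  let ?c = "\<lambda>l. partial i (\<lambda>y. G y $ j $ l) x + partial j (\<lambda>y. G y $ i $ l) x
      - partial l (\<lambda>y. G y $ i $ j) x"
  have "(\<Sum>k\<in>UNIV. G x $ m $ k * christoffel G k i j x) =
      (1/2) * (\<Sum>k\<in>UNIV. \<Sum>l\<in>UNIV. G x $ m $ k * metric_inv G x $ k $ l * ?c l)"
    by (simp add: christoffel_def sum_distrib_left mult_ac)
  also have "\<dots> = (1/2) * (\<Sum>l\<in>UNIV. (\<Sum>k\<in>UNIV. G x $ m $ k * metric_inv G x $ k $ l) * ?c l)"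
    by (subst sum.swap) (simp add: sum_distrib_right)
  also have "\<dots> = (1/2) * ?c m"
    by (simp only: metric_inv_mult_metric(2)[OF assms])
       (simp add: if_distrib[where f="\<lambda>t. t * _"] cong: if_cong)
  finally show ?thesis .
qed

text \<open>Writing \<open>\<theta> = G X\<close>, rather than \<open>X = G\<^sup>-\<^sup>1 \<theta>\<close>, means that only products are differentiated and
  no derivative of the inverse metric ever appears.\<close>

context
  fixes \<theta> X :: "real ^ 'n \<Rightarrow> real ^ 'n"
  assumes smooth_X: "smooth_on S X"
    and lower_X: "\<And>x. x \<in> S \<Longrightarrow> \<theta> x = G x *v X x"
begin

lemma partial_lowered:
  assumes "x \<in> S"
  shows "partial i (\<lambda>y. \<theta> y $ j) x = (\<Sum>k\<in>UNIV.
    partial i (\<lambda>y. G y $ j $ k) x * X x $ k + G x $ j $ k * partial i (\<lambda>y. X y $ k) x)"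
proof -
  have "Ck_on 1 S G" and "Ck_on 1 S X"
    using smooth_G smooth_X by (auto simp: smooth_on_def)
  then have "G differentiable (at x)" and "X differentiable (at x)"
    using assms by auto
  moreover have "partial i (\<lambda>y. \<theta> y $ j) x = partial i (\<lambda>y. \<Sum>k\<in>UNIV. G y $ j $ k * X y $ k) x"
    by (rule partial_cong[OF open_S assms]) (simp add: lower_X matrix_vector_mult_def)
  ultimately show ?thesis
    by (simp add: partial_sum_mult differentiable_vec_nth)
qed

lemma christoffel_lowered:
  assumes "x \<in> S"
  shows "(\<Sum>k\<in>UNIV. christoffel G k i j x * \<theta> x $ k) = (\<Sum>k\<in>UNIV. (1/2) *
    (partial i (\<lambda>y. G y $ j $ k) x + partial j (\<lambda>y. G y $ i $ k) x
      - partial k (\<lambda>y. G y $ i $ j) x) * X x $ k)"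
proof -
  have "(\<Sum>k\<in>UNIV. christoffel G k i j x * \<theta> x $ k) =
      (\<Sum>k\<in>UNIV. \<Sum>m\<in>UNIV. G x $ m $ k * christoffel G k i j x * X x $ m)"
    by (simp add: lower_X assms matrix_vector_mult_def sum_distrib_left mult_ac G_sym[OF assms])
  also have "\<dots> = (\<Sum>m\<in>UNIV. (\<Sum>k\<in>UNIV. G x $ m $ k * christoffel G k i j x) * X x $ m)"
    by (subst sum.swap) (simp add: sum_distrib_right)
  finally show ?thesis by (simp only: lower_christoffel[OF assms])
qed

text \<open>With \<open>\<theta>_j = G_jk X^k\<close>, the terms \<open>X^k \<partial>_i G_jk\<close> and \<open>X^k \<partial>_j G_ik\<close> produced by the
  product rule are cancelled by the Christoffel term
  \<open>2 \<Gamma>^k_ij \<theta>_k = X^k (\<partial>_i G_jk + \<partial>_j G_ik - \<partial>_k G_ij)\<close>, which leaves the transport term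
  \<open>X^k \<partial>_k G_ij\<close> of the Lie derivative.\<close>
lemma lie_metric_eq_delta_star:
  assumes "x \<in> S"
  shows "lie_metric X G x = 2 *\<^sub>R delta_star G \<theta> x"
proof -
  have "lie_metric X G x $ i $ j = 2 * delta_star G \<theta> x $ i $ j" for i j
  proof -
    have "2 * delta_star G \<theta> x $ i $ j = partial i (\<lambda>y. \<theta> y $ j) x + partial j (\<lambda>y. \<theta> y $ i) x
        - 2 * (\<Sum>k\<in>UNIV. christoffel G k i j x * \<theta> x $ k)"
      by (simp add: delta_star_def nabla_form_def christoffel_sym[OF assms, of _ j i])
    also have "\<dots> = (\<Sum>k\<in>UNIV. X x $ k * partial k (\<lambda>y. G y $ i $ j) x
        + G x $ k $ j * partial i (\<lambda>y. X y $ k) x + G x $ i $ k * partial j (\<lambda>y. X y $ k) x)"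
      unfolding partial_lowered[OF assms] christoffel_lowered[OF assms] sum_distrib_left
        sum.distrib[symmetric] sum_subtractf[symmetric]
      by (rule sum.cong) (auto simp: algebra_simps G_sym[OF assms, of j])
    finally show ?thesis by (simp add: lie_metric_def)
  qed
  then show ?thesis by (simp add: vec_eq_iff)
qed

text \<open>The connection is compatible with the metric, so covariant differentiation commutes with
  lowering the index.\<close>
lemma nabla_form_eq_lowered_nabla_vec:
  assumes "x \<in> S"
  shows "nabla_form G \<theta> i j x = (\<Sum>k\<in>UNIV. G x $ j $ k * nabla_vec G X i k x)"
proof -
  have sym: "partial k (\<lambda>y. G y $ i $ j) x = partial k (\<lambda>y. G y $ j $ i) x" for k i j
    by (rule partial_cong[OF open_S assms]) (rule G_sym)
  have "(\<Sum>k\<in>UNIV. G x $ j $ k * nabla_vec G X i k x) =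
      (\<Sum>k\<in>UNIV. G x $ j $ k * partial i (\<lambda>y. X y $ k) x)
      + (\<Sum>k\<in>UNIV. \<Sum>l\<in>UNIV. G x $ j $ k * christoffel G k i l x * X x $ l)"
    by (simp add: nabla_vec_def distrib_left sum.distrib sum_distrib_left mult_ac)
  also have "(\<Sum>k\<in>UNIV. \<Sum>l\<in>UNIV. G x $ j $ k * christoffel G k i l x * X x $ l) =
      (\<Sum>l\<in>UNIV. (\<Sum>k\<in>UNIV. G x $ j $ k * christoffel G k i l x) * X x $ l)"
    by (subst sum.swap) (simp add: sum_distrib_right)
  also have "(\<Sum>k\<in>UNIV. G x $ j $ k * partial i (\<lambda>y. X y $ k) x) + \<dots> = nabla_form G \<theta> i j x"
    unfolding nabla_form_def lower_christoffel[OF assms] partial_lowered[OF assms]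
      christoffel_lowered[OF assms] sum.distrib[symmetric] sum_subtractf[symmetric]
    by (rule sum.cong) (auto simp: algebra_simps sym[of _ j])
  finally show ?thesis ..
qed

lemma divergence_eq_codiff:
  assumes "x \<in> S"
  shows "divergence G X x = - codiff G \<theta> x"
proof -
  have "- codiff G \<theta> x = (\<Sum>i\<in>UNIV. \<Sum>j\<in>UNIV. \<Sum>k\<in>UNIV.
      metric_inv G x $ i $ j * G x $ i $ k * nabla_vec G X j k x)"
    by (simp add: codiff_def nabla_form_eq_lowered_nabla_vec[OF assms] sum_distrib_left mult_ac)
  also have "\<dots> = (\<Sum>j\<in>UNIV. \<Sum>k\<in>UNIV. \<Sum>i\<in>UNIV.
      metric_inv G x $ i $ j * G x $ i $ k * nabla_vec G X j k x)"
    by (subst sum.swap, rule sum.cong[OF refl], subst sum.swap, rule refl)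
  also have "\<dots> = (\<Sum>j\<in>UNIV. \<Sum>k\<in>UNIV.
      (\<Sum>i\<in>UNIV. G x $ k $ i * metric_inv G x $ i $ j) * nabla_vec G X j k x)"
    by (simp add: sum_distrib_right G_sym[OF assms, of k for k] mult.commute[of "metric_inv G x $ _ $ _"])
  also have "\<dots> = divergence G X x"
    by (simp only: metric_inv_mult_metric(2)[OF assms])
       (simp add: divergence_def if_distrib[where f="\<lambda>t. t * _"] cong: if_cong)
  finally show ?thesis ..
qed

end

lemma metric_inv_sym:
  assumes "x \<in> S"
  shows "metric_inv G x $ i $ j = metric_inv G x $ j $ i"
proof -
  let ?H = "matrix_inv (G x)"
  note inv = matrix_inv_left[OF invertible_G[OF assms]] matrix_inv_right[OF invertible_G[OF assms]]
  have "transpose ?H ** G x = transpose (G x ** ?H)"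
    by (simp add: matrix_transpose_mul transpose_G[OF assms])
  then have "transpose ?H ** G x = mat 1"
    by (simp add: inv)
  then have "transpose ?H = ?H"
    by (metis inv(2) matrix_mul_assoc matrix_mul_lid matrix_mul_rid)
  then have "transpose ?H $ i $ j = ?H $ i $ j" by simp
  then show ?thesis by (simp add: transpose_def metric_inv_def)
qed

text \<open>The trace against the symmetric \<open>g^ij\<close> does not see the symmetrisation in
  \<open>\<delta>\<^sup>* \<theta>\<close>.\<close>
lemma trace_delta_star:
  assumes "x \<in> S"
  shows "(\<Sum>i\<in>UNIV. \<Sum>j\<in>UNIV. metric_inv G x $ i $ j * delta_star G \<theta> x $ i $ j)
    = - codiff G \<theta> x"
proof -
  have "(\<Sum>i\<in>UNIV. \<Sum>j\<in>UNIV. metric_inv G x $ i $ j * nabla_form G \<theta> i j x)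
      = (\<Sum>i\<in>UNIV. \<Sum>j\<in>UNIV. metric_inv G x $ i $ j * nabla_form G \<theta> j i x)"
    by (subst sum.swap) (simp add: metric_inv_sym[OF assms])
  then show ?thesis
    by (simp add: delta_star_def codiff_def sum.distrib distrib_left sum_divide_distrib[symmetric]
        flip: add_divide_distrib)
qed

context
  fixes \<theta> :: "real ^ 'n \<Rightarrow> real ^ 'n" and a :: real and x :: "real ^ 'n"
  assumes x: "x \<in> S"
    and dim: "CARD('n) \<ge> 3"
    and gauge: "einstein G x = B_star G \<theta> x
      - ((real CARD('n) - 2) / (2 * real CARD('n)) * a) *\<^sub>R G x"
begin

text \<open>The trace of the gauge equation carries the factor \<open>n - 2\<close>; this is the place where the dimension
  must exceed 2.\<close>
lemma codiff_gauge: "codiff G \<theta> x = a - scal G x"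
proof -
  define n where "n = real CARD('n)"
  have n: "n \<ge> 3" using dim by (simp add: n_def)
  let ?tr = "\<lambda>T :: real ^ 'n ^ 'n. \<Sum>i\<in>UNIV. \<Sum>j\<in>UNIV. metric_inv G x $ i $ j * T $ i $ j"
  have tr_add: "?tr (T + U) = ?tr T + ?tr U" and tr_diff: "?tr (T - U) = ?tr T - ?tr U"
    and tr_scale: "?tr (r *\<^sub>R T) = r * ?tr T" for T U r
    by (simp_all add: algebra_simps sum.distrib sum_subtractf sum_distrib_left)
  have "?tr (einstein G x) = scal G x - scal G x / 2 * n"
    by (simp only: einstein_def tr_diff tr_scale trace_metric[OF x] n_def) (simp add: scal_def)
  moreover have "?tr (einstein G x) = - codiff G \<theta> x + codiff G \<theta> x / 2 * n
      - (n - 2) / (2 * n) * a * n"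
    unfolding gauge B_star_def tr_diff tr_add tr_scale trace_delta_star[OF x] trace_metric[OF x] n_def
    by simp
  moreover have "(n - 2) / (2 * n) * a * n = (n - 2) * a / 2"
    using n by simp
  ultimately have "(n - 2) * codiff G \<theta> x = (n - 2) * (a - scal G x)"
    by (simp add: algebra_simps)
  then show ?thesis using n by simp
qed

lemma ricci_gauge: "ricci G x = delta_star G \<theta> x + (a / real CARD('n)) *\<^sub>R G x"
proof -
  define n where "n = real CARD('n)"
  have n: "n \<ge> 3" using dim by (simp add: n_def)
  have "ricci G x = delta_star G \<theta> x
      + (scal G x / 2 + (a - scal G x) / 2 - (n - 2) / (2 * n) * a) *\<^sub>R G x"
    using gauge by (simp add: einstein_def B_star_def codiff_gauge n_def algebra_simps)
  also have "scal G x / 2 + (a - scal G x) / 2 - (n - 2) / (2 * n) * a = a / n"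
    using n by (simp add: field_simps)
  finally show ?thesis by (simp add: n_def)
qed

end

end

section \<open>The dual vector field of a one-form\<close>

lemma local_metric_chart:
  assumes "smooth_manifold M A" and "riemannian_metric A g" and "c \<in> A"
  shows "local_metric (chart_img c) (g c)"
  using assms by unfold_locales
    (auto simp: smooth_manifold_def is_chart_def riemannian_metric_def)

lemma smooth_sharp:
  assumes "local_metric S (g c)" and "smooth_on S (\<theta> c)"
  shows "smooth_on S (sharp g \<theta> c)"
proof -
  interpret local_metric S "g c" by fact
  have "Ck_on k S (\<lambda>x. metric_inv (g c) x *v \<theta> c x)" for k
    using assms(2) Ck_on_matrix_inv[OF open_S invertible_G smooth_G]
    by (intro Ck_on_bilinear[OF open_S bounded_bilinear_matrix_vector_mult])
      (auto simp: smooth_on_def metric_inv_def)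
  then show ?thesis by (simp add: smooth_on_def sharp_def[abs_def])
qed

lemma metric_mult_sharp:
  assumes "local_metric S (g c)" and "x \<in> S"
  shows "g c x *v sharp g \<theta> c x = \<theta> c x"
  using matrix_inv_right[OF local_metric.invertible_G[of S "g c", OF assms]]
  by (simp add: sharp_def metric_inv_def matrix_vector_mul_assoc)

text \<open>Let \<open>J\<close> be the Jacobian. Inserting \<open>g_c = J\<^sup>T g_d J\<close> and \<open>\<theta>_c = J\<^sup>T \<theta>_d\<close> into
  \<open>g_c X_c = \<theta>_c\<close> and cancelling \<open>J\<^sup>T\<close> leaves \<open>g_d (J X_c) = \<theta>_d\<close>. The same law for the metric
  shows that \<open>J\<close> is invertible, because \<open>det g_c = (det J)\<^sup>2 det g_d\<close> does not vanish.\<close>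
lemma sharp_transition:
  assumes "smooth_manifold M A" and g: "riemannian_metric A g" and \<theta>: "smooth_one_form A \<theta>"
    and cd: "c \<in> A" "d \<in> A" and x: "x \<in> overlap c d"
  shows "sharp g \<theta> d (transition c d x) = transition_jacobian c d x *v sharp g \<theta> c x"
proof -
  define y where "y = transition c d x"
  define J where "J = transition_jacobian c d x"
  interpret gc: local_metric "chart_img c" "g c" using assms by (intro local_metric_chart)
  interpret gd: local_metric "chart_img d" "g d" using assms by (intro local_metric_chart)
  obtain p where p: "p \<in> chart_dom c" "p \<in> chart_dom d" "x = chart_map c p"
    using x by (auto simp: overlap_def)
  have x': "x \<in> chart_img c" using p by (simp add: chart_img_def)
  have "inj_on (chart_map c) (topspace (subtopology M (chart_dom c)))"
    using assms(1) cd by (auto simp: smooth_manifold_def is_chart_def homeomorphic_eq_everything_map)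
  moreover have "chart_dom c \<subseteq> topspace M"
    using assms(1) cd by (auto simp: smooth_manifold_def is_chart_def dest: openin_subset)
  ultimately have "inj_on (chart_map c) (chart_dom c)" by (simp add: Int_absorb1)
  then have "y = chart_map d p" using p by (simp add: y_def transition_def)
  then have y: "y \<in> chart_img d" using p by (simp add: chart_img_def)
  have gJ: "g c x = transpose J ** g d y ** J"
    using g cd x by (simp add: riemannian_metric_def y_def J_def)
  have "\<theta> c x = transpose J *v \<theta> d y"
    using \<theta> cd x by (simp add: smooth_one_form_def y_def J_def)
  then have "transpose J *v (g d y *v (J *v sharp g \<theta> c x)) = transpose J *v \<theta> d y"
    using metric_mult_sharp[of _ g c, OF gc.local_metric_axioms x', of \<theta>]
    by (simp add: gJ matrix_vector_mul_assoc matrix_mul_assoc)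
  moreover have "det (g c x) \<noteq> 0"
    using gc.invertible_G[OF x'] by (simp add: invertible_det_nz)
  then have "invertible (transpose J)"
    by (auto simp: gJ det_mul det_transpose invertible_det_nz)
  ultimately have "g d y *v (J *v sharp g \<theta> c x) = \<theta> d y"
    by (metis matrix_inv_left matrix_vector_mul_assoc matrix_vector_mul_lid)
  then have "metric_inv (g d) y *v (g d y *v (J *v sharp g \<theta> c x)) = sharp g \<theta> d y"
    by (simp add: sharp_def)
  then show ?thesis
    using matrix_inv_left[OF gd.invertible_G[OF y]]
    by (simp add: metric_inv_def matrix_vector_mul_assoc matrix_mul_assoc J_def y_def)
qed

lemma lie_metric_uminus:
  assumes "X differentiable (at x)"
  shows "lie_metric (\<lambda>y. - X y) G x = - lie_metric X G x"
proof -
  have "partial i (\<lambda>y. - (X y $ k)) x = - partial i (\<lambda>y. X y $ k) x" for i k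
    using has_derivative_minus[OF differentiable_vec_nth[OF assms, of k,
        unfolded frechet_derivative_works]]
    by (subst partial_eqI) (auto simp: partial_def)
  then show ?thesis
    by (simp add: lie_metric_def vec_eq_iff flip: sum_negf)
qed

section \<open>Harmonic critical metrics are Ricci solitons\<close>

theorem theorem4p1:
  fixes M :: "'a topology"
    and A :: "('a, 'n::finite) chart set"
    and g :: "('a, 'n, real ^ 'n ^ 'n) field"
  assumes "smooth_manifold M A"
    and "compact_space M"
    and "CARD('n) \<ge> 3"
    and "riemannian_metric A g"
  shows "(harmonic_critical M A g \<longrightarrow> ricci_soliton_metric A g) \<and>
    (\<forall>\<theta>. gauge_one_form M A g \<theta> \<longrightarrow>
      (\<exists>lam. lam = avg_scalar_curvature M A g / real CARD('n) \<and>
        lam = 1 / (real CARD('n) * total_volume M A g)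
                * (\<integral>p. scalar_curvature A g p \<partial>volume_measure M A g) \<and>
        ricci_soliton A g (\<lambda>c x. - sharp g \<theta> c x) lam) \<and>
      (\<forall>c\<in>A. \<forall>x\<in>chart_img c.
        divergence (g c) (sharp g \<theta> c) x = scal (g c) x - avg_scalar_curvature M A g))"
proof -
  have soliton: "ricci_soliton A g (\<lambda>c x. - sharp g \<theta> c x) (avg_scalar_curvature M A g / real CARD('n))"
    and div: "\<forall>c\<in>A. \<forall>x\<in>chart_img c.
        divergence (g c) (sharp g \<theta> c) x = scal (g c) x - avg_scalar_curvature M A g"
    if gauge: "gauge_one_form M A g \<theta>" for \<theta>
  proof -
    let ?X = "sharp g \<theta>"
    have \<theta>: "smooth_one_form A \<theta>" using gauge by (simp add: gauge_one_form_def)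
    have local: "local_metric (chart_img c) (g c)" if "c \<in> A" for c
      using assms(1,4) that by (rule local_metric_chart)
    have smooth_X: "smooth_on (chart_img c) (?X c)" if "c \<in> A" for c
      using \<theta> that by (intro smooth_sharp local) (auto simp: smooth_one_form_def)
    have "smooth_vector_field A (\<lambda>c x. - ?X c x)"
      unfolding smooth_vector_field_def
    proof (intro conjI ballI)
      fix c assume "c \<in> A"
      then show "smooth_on (chart_img c) (\<lambda>x. - ?X c x)"
        using smooth_X[of c] Ck_on_uminus[OF local_metric.open_S[OF local]]
        unfolding smooth_on_def by blast
    next
      fix c d x assume "c \<in> A" "d \<in> A" "x \<in> overlap c d"
      then have "?X d (transition c d x) = transition_jacobian c d x *v ?X c x"
        using assms(1,4) \<theta> by (intro sharp_transition)
      then show "- ?X d (transition c d x) = transition_jacobian c d x *v - ?X c x"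
        by (simp add: bounded_bilinear.minus_right[OF bounded_bilinear_matrix_vector_mult])
    qed
    moreover have "ricci (g c) x + (1/2) *\<^sub>R lie_metric (\<lambda>x. - ?X c x) (g c) x
          = (avg_scalar_curvature M A g / real CARD('n)) *\<^sub>R g c x"
      and "divergence (g c) (?X c) x = scal (g c) x - avg_scalar_curvature M A g"
      if c: "c \<in> A" and x: "x \<in> chart_img c" for c x
    proof -
      interpret local_metric "chart_img c" "g c" using c by (rule local)
      note X = smooth_X[OF c] metric_mult_sharp[of _ g c, OF local_metric_axioms, symmetric]
      have eq: "einstein (g c) x = B_star (g c) (\<theta> c) x
          - ((real CARD('n) - 2) / (2 * real CARD('n)) * avg_scalar_curvature M A g) *\<^sub>R g c x"
        using gauge c x by (simp add: gauge_one_form_def)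
      show "divergence (g c) (?X c) x = scal (g c) x - avg_scalar_curvature M A g"
        using divergence_eq_codiff[OF X x] codiff_gauge[OF x assms(3) eq] by simp
      have "Ck_on 1 (chart_img c) (?X c)" using X(1) by (simp add: smooth_on_def)
      then have "lie_metric (\<lambda>x. - ?X c x) (g c) x = - 2 *\<^sub>R delta_star (g c) (\<theta> c) x"
        using x lie_metric_eq_delta_star[OF X x] by (subst lie_metric_uminus) auto
      then show "ricci (g c) x + (1/2) *\<^sub>R lie_metric (\<lambda>x. - ?X c x) (g c) x
          = (avg_scalar_curvature M A g / real CARD('n)) *\<^sub>R g c x"
        using ricci_gauge[OF x assms(3) eq] by simp
    qed
    ultimately show
      "ricci_soliton A g (\<lambda>c x. - ?X c x) (avg_scalar_curvature M A g / real CARD('n))"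
      and "\<forall>c\<in>A. \<forall>x\<in>chart_img c.
        divergence (g c) (?X c) x = scal (g c) x - avg_scalar_curvature M A g"
      by (simp_all add: ricci_soliton_def)
  qed
  have "avg_scalar_curvature M A g / real CARD('n) = 1 / (real CARD('n) * total_volume M A g)
      * (\<integral>p. scalar_curvature A g p \<partial>volume_measure M A g)"
    by (simp add: avg_scalar_curvature_def)
  with soliton div show ?thesis
    unfolding harmonic_critical_def ricci_soliton_metric_def by blast
qed

end
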